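(* Let $D$ be a strongly connected digraph of order $n\geq 3$ and let $z_0$ be a vertex of $D$ such that $d(x)+d(y)\geq 2n-1$ for every pair of non-adjacent distinct vertices $x,y\in V(D)\setminus\{z_0\}$. Then $D$ is Hamiltonian or contains a directed cycle of length $n-1$.
   Context: All digraphs are finite, without loops and without multiple arcs (opposite arcs $xy$ and $yx$ may both be present; a pair of opposite arcs forms a cycle of length 2). For a vertex $x$, $d(x)=d^+(x)+d^-(x)$. Two distinct vertices $x,y$ are adjacent if $xy$ or $yx$ is an arc. A digraph is Hamiltonian if it contains a directed cycle through all its vertices; the length of a cycle is its number of vertices. *)

theory Defs
  imports "Graph_Theory.Graph_Theory"
begin

definition degree :: "('a, 'b) pre_digraph \<Rightarrow> 'a \<Rightarrow> nat" where
  "degree G x = out_degree G x + in_degree G x"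

definition adjacent :: "('a, 'b) pre_digraph \<Rightarrow> 'a \<Rightarrow> 'a \<Rightarrow> bool" where
  "adjacent G x y \<longleftrightarrow> x \<noteq> y \<and> (x \<rightarrow>\<^bsub>G\<^esub> y \<or> y \<rightarrow>\<^bsub>G\<^esub> x)"

text \<open>
  A cycle is a list of arcs, so its length as a list is its number of vertices; in a loop-free
  digraph it is at least 2. The base vertex u is immaterial for the vertices of a nonempty walk.
\<close>
definition hamiltonian :: "('a, 'b) pre_digraph \<Rightarrow> bool" where
  "hamiltonian G \<longleftrightarrow>
    (\<exists>u p. pre_digraph.cycle G p \<and> pre_digraph.awalk G u p u \<and>
      set (pre_digraph.awalk_verts G u p) = verts G)"

definition has_cycle_of_length :: "('a, 'b) pre_digraph \<Rightarrow> nat \<Rightarrow> bool" where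
  "has_cycle_of_length G k \<longleftrightarrow> (\<exists>p. pre_digraph.cycle G p \<and> length p = k)"

end

theory Submission
  imports Defs
begin

text \<open>
  A variation on Bondy and Thomassen's proof of Meyniel's theorem. Take a cycle $C$ that is maximal
  first in the number of vertices other than $z_0$ it contains, then in length, and suppose that it
  misses a vertex other than $z_0$. We look for two non-adjacent vertices other than $z_0$ with
  degree sum at most $2n-2$.

  Call a path outside $C$ joining two vertices $a \neq b$ of $C$ a bypass if it has an inner vertex
  $x \neq z_0$. If there is a bypass, choose one for which the gap, that is the segment of $C$ from
  $a$ to $b$, is shortest. Take a longest path from $b$ to $a$ on vertices of $C$ that contains the
  rest of $C$. By maximality of $C$ it misses a vertex $v \neq z_0$ of the gap. Neither can $v$ be
  inserted into this path nor $x$ into the rest of $C$, and by minimality of the gap $x$ and $v$ are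
  non-adjacent and have at most two arcs in total with each further vertex outside $C$. The vertex
  $z_0$ may violate the last bound, but only if $a \to x$ or $x \to b$ is missing, which improves
  the bound for $x$ accordingly. If there is no bypass, a vertex $y \neq z_0$ outside $C$ has at most
  one neighbour on $C$; it is paired with another vertex of $C$, where $y$ is chosen adjacent to $C$
  if possible.
\<close>

section \<open>Counting arcs between a vertex and a set\<close>

definition marcs :: "('a \<Rightarrow> 'a \<Rightarrow> bool) \<Rightarrow> 'a \<Rightarrow> 'a \<Rightarrow> nat" where
  "marcs E x w = of_bool (E x w) + of_bool (E w x)"

definition deg :: "'a set \<Rightarrow> ('a \<Rightarrow> 'a \<Rightarrow> bool) \<Rightarrow> 'a \<Rightarrow> nat" where
  "deg V E x = (\<Sum>w\<in>V. marcs E x w)"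

lemma marcs_conversep [simp]: "marcs E\<inverse>\<inverse> = marcs E"
  by (simp add: marcs_def fun_eq_iff)

lemma deg_conversep [simp]: "deg V E\<inverse>\<inverse> = deg V E"
  by (simp add: deg_def fun_eq_iff)

lemma marcs_le: "marcs E x w \<le> 2"
  by (simp add: marcs_def of_bool_def)

lemma marcs_self: "\<not> E x x \<Longrightarrow> marcs E x x = 0"
  by (simp add: marcs_def)

lemma sum_marcs_le: "(\<Sum>w\<in>A. marcs E x w) \<le> 2 * card A"
  using sum_bounded_above[of A "marcs E x" 2] marcs_le[of E x] by simp

lemma sum_marcs_self_le:
  assumes "finite A" "x \<in> A" "\<not> E x x"
  shows "(\<Sum>w\<in>A. marcs E x w) + 2 \<le> 2 * card A"
proof -
  have "(\<Sum>w\<in>A. marcs E x w) = (\<Sum>w\<in>A - {x}. marcs E x w)"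
    using assms by (simp add: sum.remove marcs_self)
  also have "\<dots> \<le> 2 * card (A - {x})"
    by (rule sum_marcs_le)
  finally show ?thesis
    using assms by (cases "card A") auto
qed

text \<open>Serves to bound the joint number of arcs that two non-adjacent vertices have with the
  set \<open>R\<close> off the cycle: 2 per vertex on average, up to \<open>t\<close> more for
  \<open>z\<close>, while \<open>x\<close>, the one of the two that lies in \<open>R\<close>,
  contributes nothing and thereby saves 2.\<close>

lemma sum_le_with_excess:
  fixes s :: "'a \<Rightarrow> nat"
  assumes "finite R" "x \<in> R" "s x = 0"
    and "\<And>w. w \<in> R - {x} \<Longrightarrow> s w \<le> 2 + (if w = z then t else 0)"
  shows "sum s R + 2 \<le> 2 * card R + t"
proof -
  have "sum s R = sum s (R - {x})"
    using assms by (simp add: sum.remove)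
  also have "\<dots> \<le> (\<Sum>w\<in>R - {x}. 2 + (if w = z then t else 0))"
    using assms(4) by (rule sum_mono)
  also have "\<dots> \<le> 2 * card (R - {x}) + t"
    unfolding sum.distrib using \<open>finite R\<close> by simp
  finally show ?thesis
    using assms by (cases "card R") auto
qed

text \<open>For consecutive \<open>u\<close>, \<open>w\<close> at most one of the arcs from
  \<open>u\<close> to \<open>y\<close> and from \<open>y\<close> to \<open>w\<close> exists. These
  \<open>length Q - 1\<close> pairs cover all arcs between \<open>y\<close> and \<open>Q\<close>
  except those from \<open>y\<close> to the first vertex and from the last vertex to
  \<open>y\<close>.\<close>

lemma sum_marcs_noninsertable:
  assumes "distinct Q" "Q \<noteq> []"
    and "\<And>q1 u w q2. Q = q1 @ u # w # q2 \<Longrightarrow> \<not> (E u y \<and> E y w)"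
  shows "Suc (\<Sum>w\<in>set Q. marcs E y w) \<le> length Q + of_bool (E y (hd Q)) + of_bool (E (last Q) y)"
  using assms
proof (induction Q)
  case (Cons q Q)
  show ?case
  proof (cases Q)
    case Nil
    then show ?thesis by (simp add: marcs_def)
  next
    case (Cons q' r)
    have IH: "Suc (\<Sum>w\<in>set Q. marcs E y w) \<le> length Q + of_bool (E y (hd Q)) + of_bool (E (last Q) y)"
    proof (rule Cons.IH)
      show "\<not> (E u y \<and> E y w)" if "Q = q1 @ u # w # q2" for q1 u w q2
        using Cons.prems(3)[of "q # q1" u w q2] that by simp
    qed (use Cons.prems Cons in auto)
    have "\<not> (E q y \<and> E y q')"
      using Cons.prems(3)[of "[]" q q' r] Cons by simp
    then show ?thesis
      using IH Cons Cons.prems(1) by (auto simp: marcs_def)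
  qed
qed simp

section \<open>Cycles, bypasses and insertion of a vertex into a path\<close>

text \<open>Maximizing this weight first maximizes the number of elements other than \<open>z\<close>.\<close>

definition weight :: "'a \<Rightarrow> 'a set \<Rightarrow> nat" where
  "weight z S = card S + card (S - {z})"

definition is_cycle :: "('a \<Rightarrow> 'a \<Rightarrow> bool) \<Rightarrow> 'a list \<Rightarrow> bool" where
  "is_cycle E C \<longleftrightarrow> 2 \<le> length C \<and> distinct C \<and> successively E (C @ [hd C])"

text \<open>The cycle is \<open>a # g @ b # h\<close>, its gap is \<open>g\<close>, and \<open>p\<close> consists of the inner vertices of the bypass.\<close>

definition theta :: "('a \<Rightarrow> 'a \<Rightarrow> bool) \<Rightarrow> 'a \<Rightarrow> 'a list \<Rightarrow> 'a \<Rightarrow> 'a list \<Rightarrow> 'a list \<Rightarrow> bool" where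
  "theta E a g b h p \<longleftrightarrow> distinct (a # g @ b # h @ p) \<and>
     successively E (a # g @ [b]) \<and> successively E (b # h @ [a]) \<and> successively E (a # p @ [b])"

text \<open>Only the vertex set of the cycle is fixed, so every rotation and every other splitting
  of the cycle competes automatically; the maximality of the cycle used later also depends on this
  set alone.\<close>

definition min_theta ::
  "('a \<Rightarrow> 'a \<Rightarrow> bool) \<Rightarrow> 'a \<Rightarrow> 'a \<Rightarrow> 'a list \<Rightarrow> 'a \<Rightarrow> 'a list \<Rightarrow> 'a list \<Rightarrow> bool" where
  "min_theta E z a g b h p \<longleftrightarrow> theta E a g b h p \<and> \<not> set p \<subseteq> {z} \<and>
     (\<forall>a' g' b' h' p'. theta E a' g' b' h' p' \<longrightarrow> \<not> set p' \<subseteq> {z} \<longrightarrow>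
        set (a' # g' @ b' # h') = set (a # g @ b # h) \<longrightarrow> length g \<le> length g')"

lemma successively_append_overlap: "successively P (xs @ y # ys) \<longleftrightarrow> successively P (xs @ [y]) \<and> successively P (y # ys)"
  by (induction xs rule: induct_list012) (auto simp: successively_Cons)

lemma successively_conversep_rev: "successively E\<inverse>\<inverse> xs \<longleftrightarrow> successively E (rev xs)"
  by (simp add: successively_rev conversep_iff[abs_def])

text \<open>The new vertex goes between two consecutive ones, so the end vertices \<open>b\<close>
  and \<open>a\<close> survive and only the inner list changes.\<close>

lemma successively_insert:
  assumes "b # l @ [a] = q1 @ u # w # q2" "successively E (b # l @ [a])" "E u y" "E y w"
  shows "\<exists>l1 l2. l = l1 @ l2 \<and> successively E (b # l1 @ y # l2 @ [a])"
proof -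
  have *: "successively E (q1 @ u # y # w # q2)"
    using assms successively_append_overlap[of E q1 u "y # w # q2"] successively_append_overlap[of E q1 u "w # q2"] by simp
  obtain r1 where r1: "q1 @ [u] = b # r1"
    using assms(1) by (cases q1) auto
  obtain r2 where r2: "w # q2 = r2 @ [a]"
    using arg_cong[OF assms(1), of last] by (metis append_butlast_last_id last_ConsR last_appendR last_snoc list.discI append_is_Nil_conv)
  have "b # l @ [a] = b # r1 @ r2 @ [a]"
    using assms(1) r1 r2 by (metis append.assoc append_Cons append_Nil)
  moreover have "successively E (b # r1 @ y # r2 @ [a])"
    using * r1 r2 by (metis append.assoc append_Cons append_Nil)
  ultimately show ?thesis by auto
qed

lemma weight_mono: "finite T \<Longrightarrow> S \<subseteq> T \<Longrightarrow> weight z S \<le> weight z T"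
  unfolding weight_def by (intro add_mono card_mono) auto

section \<open>Bypasses with a shortest gap and the resulting degree sum\<close>

lemma theta_conversep:
  assumes "theta E a g b h p"
  shows "theta E\<inverse>\<inverse> b (rev g) a (rev h) (rev p)"
  using assms unfolding theta_def successively_conversep_rev by auto

text \<open>Reversing all arcs exchanges \<open>a\<close> and \<open>b\<close>, so facts about arcs
  leaving the bypass carry over to arcs entering it.\<close>

lemma min_theta_conversep:
  assumes "min_theta E z a g b h p"
  shows "min_theta E\<inverse>\<inverse> z b (rev g) a (rev h) (rev p)"
  unfolding min_theta_def
proof (intro conjI allI impI)
  fix a' g' b' h' p'
  assume t: "theta E\<inverse>\<inverse> a' g' b' h' p'" and p: "\<not> set p' \<subseteq> {z}"
    and s: "set (a' # g' @ b' # h') = set (b # rev g @ a # rev h)"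
  have "theta E b' (rev g') a' (rev h') (rev p')"
    using theta_conversep[OF t] by simp
  moreover have "set (b' # rev g' @ a' # rev h') = set (a # g @ b # h)"
    using s by auto
  ultimately have "length g \<le> length (rev g')"
    using assms p unfolding min_theta_def by (metis set_rev)
  then show "length (rev g) \<le> length g'" by simp
qed (use assms theta_conversep[of E a g b h p] in \<open>auto simp: min_theta_def\<close>)

text \<open>A path from \<open>a\<close> into the gap at \<open>v\<close> with an inner vertex other
  than \<open>z\<close> would be a bypass whose gap is a proper initial part of
  \<open>g\<close>.\<close>

lemma min_theta_gap:
  assumes "min_theta E z a g b h p" "v \<in> set g"
    and "distinct p'" "set p' \<inter> set (a # g @ b # h) = {}" "successively E (a # p' @ [v])"
  shows "set p' \<subseteq> {z}"
proof (rule ccontr)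
  assume p': "\<not> set p' \<subseteq> {z}"
  obtain g1 g2 where g: "g = g1 @ v # g2"
    using assms(2) by (meson split_list)
  have "theta E a g b h p"
    using assms(1) by (simp add: min_theta_def)
  \<comment> \<open>The cycle stays the same; it is merely split at \<open>v\<close> instead of
    \<open>b\<close>, and the rest of the gap joins \<open>h\<close>.\<close>
  then have "theta E a g1 v (g2 @ b # h) p'"
    using assms(3-5) successively_append_overlap[of E "a # g1" v "g2 @ [b]"]
      successively_append_overlap[of E "v # g2" b "h @ [a]"]
    unfolding theta_def g by auto
  moreover have "set (a # g1 @ v # (g2 @ b # h)) = set (a # g @ b # h)"
    unfolding g by auto
  ultimately have "length g \<le> length g1"
    using assms(1) p' unfolding min_theta_def by metis
  then show False by (simp add: g)
qed

text \<open>Follow the bypass from \<open>a\<close> to \<open>x\<close> and leave it for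
  \<open>v\<close>, directly or through \<open>w\<close>: this enters the gap too early. The only
  escape is that \<open>w\<close> already occurs before \<open>x\<close> on the bypass, and then the
  part up to \<open>w\<close> forces \<open>w = z\<close>.\<close>

lemma min_theta_out:
  assumes t: "min_theta E z a g b h p" and v: "v \<in> set g" and x: "x \<in> set p" "x \<noteq> z"
  shows "\<not> E x v"
    and "\<lbrakk>E x w; E w v; w \<notin> set (a # g @ b # h); w \<noteq> x\<rbrakk> \<Longrightarrow> w = z \<and> \<not> E a x"
proof -
  have th: "theta E a g b h p"
    using t by (simp add: min_theta_def)
  obtain p1 p2 where p: "p = p1 @ x # p2"
    using x by (meson split_list)
  have p1: "successively E (a # p1 @ [x])" "distinct (p1 @ [x])" "set (p1 @ [x]) \<inter> set (a # g @ b # h) = {}"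
    using th successively_append_overlap[of E "a # p1" x "p2 @ [b]"] unfolding theta_def p by auto
  show "\<not> E x v"
  proof
    assume "E x v"
    then have "successively E (a # (p1 @ [x]) @ [v])"
      using p1(1) successively_append_overlap[of E "a # p1" x "[v]"] by simp
    then show False
      using min_theta_gap[OF t v p1(2,3)] x by simp
  qed
  show "w = z \<and> \<not> E a x" if w: "E x w" "E w v" "w \<notin> set (a # g @ b # h)" "w \<noteq> x"
  proof -
    have "w \<in> set p1"
    proof (rule ccontr)
      assume "w \<notin> set p1"
      moreover have "successively E (a # (p1 @ [x, w]) @ [v])"
        using p1(1) w successively_append_overlap[of E "a # p1" x "[w, v]"] by simp
      ultimately have "set (p1 @ [x, w]) \<subseteq> {z}"
        using p1 w by (intro min_theta_gap[OF t v]) auto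
      then show False using x by simp
    qed
    then obtain p3 p4 where p3: "p1 = p3 @ w # p4" by (meson split_list)
    \<comment> \<open>Leaving the bypass at \<open>w\<close> avoids \<open>x\<close>, so this path
      only yields \<open>w = z\<close>. An arc from \<open>a\<close> to \<open>x\<close> would put
      \<open>x\<close> back on a path into the gap.\<close>
    have "successively E (a # (p3 @ [w]) @ [v])"
      using p1(1) w successively_append_overlap[of E "a # p3" w "p4 @ [x]"] successively_append_overlap[of E "a # p3" w "[v]"]
      unfolding p3 by simp
    then have "set (p3 @ [w]) \<subseteq> {z}"
      using p1 w unfolding p3 by (intro min_theta_gap[OF t v]) auto
    moreover have "\<not> E a x"
    proof
      assume "E a x"
      then have "set [x, w] \<subseteq> {z}"
        using p1 w by (intro min_theta_gap[OF t v]) auto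
      then show False using x by simp
    qed
    ultimately show ?thesis by simp
  qed
qed

lemma min_theta_in:
  assumes t: "min_theta E z a g b h p" and v: "v \<in> set g" and x: "x \<in> set p" "x \<noteq> z"
  shows "\<not> E v x"
    and "\<lbrakk>E v w; E w x; w \<notin> set (a # g @ b # h); w \<noteq> x\<rbrakk> \<Longrightarrow> w = z \<and> \<not> E x b"
  using min_theta_out[OF min_theta_conversep[OF t], of v x] assms by auto

lemma min_theta_degree_sum:
  assumes fin: "finite V" and EV: "\<And>u w. E u w \<Longrightarrow> u \<in> V \<and> w \<in> V" and irr: "\<And>u. \<not> E u u"
    and t: "min_theta E z a g b h p"
    and opt: "\<And>C. is_cycle E C \<Longrightarrow> weight z (set C) \<le> weight z (set (a # g @ b # h))"
  shows "\<exists>x\<in>V - {z}. \<exists>v\<in>V - {z}. x \<noteq> v \<and> \<not> E x v \<and> \<not> E v x \<and> deg V E x + deg V E v + 2 \<le> 2 * card V"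
proof -
  define C where "C = set (a # g @ b # h)"
  define Q where "Q = b # h @ [a]"
  define R where "R = V - C"
  have th: "theta E a g b h p" and pz: "\<not> set p \<subseteq> {z}"
    using t by (auto simp: min_theta_def)
  have dist: "distinct (a # g @ b # h @ p)" and ag: "successively E (a # g @ [b])" and bh: "successively E Q"
    and ap: "successively E (a # p @ [b])"
    using th by (auto simp: theta_def Q_def)
  have inV: "set (u # l @ [w]) \<subseteq> V" if "successively E (u # l @ [w])" for u l w
    using that by (induction l arbitrary: u) (use EV in auto)
  have CV: "C \<subseteq> V" "set p \<subseteq> V"
    using inV[OF ag] inV[OF bh[unfolded Q_def]] inV[OF ap] by (auto simp: C_def)
  have finC: "finite C" by (simp add: C_def)
  obtain x where x: "x \<in> set p" "x \<noteq> z" using pz by auto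
  have xR: "x \<in> R"
    using x dist CV by (auto simp: R_def C_def)

  \<comment> \<open>\<open>Q\<close> is the cycle without its gap. Competing with it are the paths
    from \<open>b\<close> to \<open>a\<close> that contain all of \<open>Q\<close> and stay on
    vertices of the cycle; \<open>Q'\<close> will be a longest one.\<close>
  define good where "good = (\<lambda>l. distinct (b # l @ [a]) \<and> successively E (b # l @ [a]) \<and>
    set Q \<subseteq> set (b # l @ [a]) \<and> set (b # l @ [a]) \<subseteq> C)"
  have "good h"
    using dist bh by (auto simp: good_def Q_def C_def)
  moreover have "\<forall>l. good l \<longrightarrow> length l < Suc (card C)"
  proof (intro allI impI)
    fix l assume "good l"
    then have "length (b # l @ [a]) = card (set (b # l @ [a]))" "set (b # l @ [a]) \<subseteq> C"
      unfolding good_def by (metis distinct_card, blast)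
    then have "length (b # l @ [a]) \<le> card C"
      using card_mono[OF finC] by metis
    then show "length l < Suc (card C)" by simp
  qed
  ultimately obtain l where l: "good l" and lmax: "\<And>l'. good l' \<Longrightarrow> length l' \<le> length l"
    using ex_has_greatest_nat[of good h length "Suc (card C)"] by (metis less_imp_le)
  define Q' where "Q' = b # l @ [a]"
  have Q': "distinct Q'" "successively E Q'" "set Q \<subseteq> set Q'" "set Q' \<subseteq> C"
    using l by (auto simp: good_def Q'_def)

  \<comment> \<open>Otherwise the bypass and \<open>Q'\<close> form a cycle that gains
    \<open>x\<close> and loses at most \<open>z\<close>. Its weight is larger because vertices other
    than \<open>z\<close> count twice.\<close>
  have "\<not> C - {z} \<subseteq> set Q'"
  proof
    assume sub: "C - {z} \<subseteq> set Q'"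
    define K where "K = a # p @ b # l"
    have disj: "set p \<inter> C = {}" using dist by (auto simp: C_def)
    have "is_cycle E K"
      using Q' ap disj dist successively_append_overlap[of E "a # p" b "l @ [a]"]
      unfolding is_cycle_def K_def Q'_def by auto
    then have le: "weight z (set K) \<le> weight z C"
      using opt by (simp add: C_def)
    have KC: "set K = set Q' \<union> set p" by (auto simp: K_def Q'_def)
    have "insert x (C - {z}) \<subseteq> set K - {z}" using sub x KC by auto
    then have "card (insert x (C - {z})) \<le> card (set K - {z})" by (intro card_mono) auto
    moreover have "x \<notin> C" using xR by (simp add: R_def)
    ultimately have *: "Suc (card (C - {z})) \<le> card (set K - {z})"
      using finC by simp
    moreover have "card (set K - {z}) \<le> card (set K)" by (intro card_mono) auto
    moreover have "card C \<le> Suc (card (C - {z}))"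
      using finC by (auto simp: card_Diff_singleton_if)
    ultimately show False using le by (simp add: weight_def)
  qed
  then obtain v where v: "v \<in> C" "v \<noteq> z" "v \<notin> set Q'" by auto
  have vg: "v \<in> set g"
    using v Q'(3) by (auto simp: C_def Q_def)

  \<comment> \<open>Each of these two arcs raises the bound on the arcs between \<open>x\<close> and
    \<open>Q\<close> by one, but also lowers the possible excess at \<open>z\<close> by one. Hence
    both cancel in the final sum.\<close>
  define \<alpha> where "\<alpha> = (of_bool (E x b) :: nat)"
  define \<beta> where "\<beta> = (of_bool (E a x) :: nat)"
  have \<alpha>\<beta>: "\<alpha> \<le> 1" "\<beta> \<le> 1" by (auto simp: \<alpha>_def \<beta>_def)
  have nadj: "\<not> E x v" "\<not> E v x"
    using min_theta_out(1)[OF t vg x] min_theta_in(1)[OF t vg x] by auto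

  have s1: "Suc (\<Sum>w\<in>set Q. marcs E x w) \<le> length Q + \<alpha> + \<beta>"
  proof -
    \<comment> \<open>Inserting \<open>x\<close> into \<open>Q\<close> and keeping the gap would
      give a cycle with one more vertex, which is not \<open>z\<close>.\<close>
    have "\<not> (E u x \<and> E x w)" if q: "Q = q1 @ u # w # q2" for q1 u w q2
    proof
      assume ux: "E u x \<and> E x w"
      obtain h1 h2 where h: "h = h1 @ h2" and bxa: "successively E (b # h1 @ x # h2 @ [a])"
        using successively_insert[of b h a q1 u w q2 E x] bh ux q unfolding Q_def by blast
      define K where "K = a # g @ b # h1 @ x # h2"
      have "is_cycle E K"
        using ag bxa dist x successively_append_overlap[of E "a # g" b "h1 @ x # h2 @ [a]"]
        unfolding is_cycle_def K_def h by auto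
      then have "weight z (set K) \<le> weight z C"
        using opt by (simp add: C_def)
      moreover have K: "set K = insert x C" by (auto simp: K_def C_def h)
      moreover have "set K - {z} = insert x (C - {z})" using K x by auto
      moreover have "x \<notin> C" using xR by (simp add: R_def)
      ultimately show False using finC by (simp add: weight_def)
    qed
    then show ?thesis
      using sum_marcs_noninsertable[of Q E x] dist by (auto simp: Q_def \<alpha>_def \<beta>_def)
  qed
  have s2: "(\<Sum>w\<in>set Q'. marcs E v w) \<le> Suc (length Q')"
  proof -
    \<comment> \<open>As \<open>v\<close> lies on the cycle but not on \<open>Q'\<close>, inserting
      it would give a longer path satisfying \<open>good\<close>.\<close>
    have "\<not> (E u v \<and> E v w)" if q: "Q' = q1 @ u # w # q2" for q1 u w q2
    proof
      assume ux: "E u v \<and> E v w"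
      obtain l1 l2 where l12: "l = l1 @ l2" and "successively E (b # l1 @ v # l2 @ [a])"
        using successively_insert[of b l a q1 u w q2 E v] Q'(2) ux q unfolding Q'_def by blast
      then have "good (l1 @ v # l2)"
        using Q' v unfolding good_def Q'_def by auto
      from lmax[OF this] show False by (simp add: l12)
    qed
    then have "Suc (\<Sum>w\<in>set Q'. marcs E v w) \<le> length Q' + of_bool (E v (hd Q')) + of_bool (E (last Q') v)"
      using sum_marcs_noninsertable[of Q' E v] Q'(1) by (auto simp: Q'_def)
    also have "\<dots> \<le> length Q' + 1 + 1" by (intro add_mono) auto
    finally show ?thesis by simp
  qed
  have s3: "(\<Sum>w\<in>C - set Q'. marcs E v w) + 2 \<le> 2 * card (C - set Q')"
    using v finC irr by (intro sum_marcs_self_le) auto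
  have s4: "(\<Sum>w\<in>C - set Q. marcs E x w) = 0"
  proof (rule sum.neutral, rule ballI)
    fix w assume "w \<in> C - set Q"
    then have "w \<in> set g" by (auto simp: C_def Q_def)
    then show "marcs E x w = 0"
      using min_theta_out(1)[OF t _ x] min_theta_in(1)[OF t _ x] by (simp add: marcs_def)
  qed
  have s5: "(\<Sum>w\<in>R. marcs E x w + marcs E v w) + 2 \<le> 2 * card R + (2 - \<alpha> - \<beta>)"
  proof (rule sum_le_with_excess[where x = x and z = z])
    show "marcs E x x + marcs E v x = 0"
      using irr nadj by (simp add: marcs_def)
    fix w assume w: "w \<in> R - {x}"
    then have wC: "w \<notin> set (a # g @ b # h)" "w \<noteq> x" by (auto simp: R_def C_def)
    \<comment> \<open>The four possible arcs are grouped into the two-step routes from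
      \<open>x\<close> to \<open>v\<close> and from \<open>v\<close> to \<open>x\<close> through
      \<open>w\<close>. A complete route is possible only for \<open>w = z\<close>, and only if the
      arc from \<open>a\<close> to \<open>x\<close>, respectively from \<open>x\<close> to
      \<open>b\<close>, is missing.\<close>
    have "of_bool (E x w) + of_bool (E w v) \<le> 1 + (if w = z then 1 - \<beta> else 0)"
      using min_theta_out(2)[OF t vg x _ _ wC] by (cases "E x w"; cases "E w v") (simp_all add: \<beta>_def)
    moreover have "of_bool (E v w) + of_bool (E w x) \<le> 1 + (if w = z then 1 - \<alpha> else 0)"
      using min_theta_in(2)[OF t vg x _ _ wC] by (cases "E v w"; cases "E w x") (simp_all add: \<alpha>_def)
    moreover have "(if w = z then 2 - \<alpha> - \<beta> else 0) = (if w = z then 1 - \<beta> else 0) + (if w = z then 1 - \<alpha> else 0)"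
      using \<alpha>\<beta> by auto
    ultimately show "marcs E x w + marcs E v w \<le> 2 + (if w = z then 2 - \<alpha> - \<beta> else 0)"
      unfolding marcs_def by linarith
  qed (use fin xR in \<open>auto simp: R_def\<close>)
  have split: "deg V E y = (\<Sum>w\<in>A. marcs E y w) + (\<Sum>w\<in>C - A. marcs E y w) + (\<Sum>w\<in>R. marcs E y w)"
    if "A \<subseteq> C" for A y
    using sum.subset_diff[OF CV(1) fin, of "marcs E y"] sum.subset_diff[OF that finC, of "marcs E y"]
    by (simp add: deg_def R_def)
  have QC: "set Q \<subseteq> C" using Q' by blast
  have cards: "card C + card R = card V" "card (set Q') + card (C - set Q') = card C" "card (set Q) \<le> card (set Q')"
    "card (set Q) = length Q" "card (set Q') = length Q'"
  proof -
    show "card C + card R = card V"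
      using card_Diff_subset[OF finC CV(1)] card_mono[OF fin CV(1)] by (simp add: R_def)
    show "card (set Q') + card (C - set Q') = card C"
      using card_Diff_subset[OF _ Q'(4)] card_mono[OF finC Q'(4)] by simp
    show "card (set Q) \<le> card (set Q')" using Q'(3) by (intro card_mono) auto
    show "card (set Q) = length Q" using dist by (intro distinct_card) (auto simp: Q_def)
    show "card (set Q') = length Q'" using Q'(1) by (rule distinct_card)
  qed
  \<comment> \<open>The bounds add up to |Q| + |Q'| + 2|C - Q'| + 2|R| - 2, and |Q| is at most
    |Q'|.\<close>
  have "deg V E x + deg V E v + 2 \<le> 2 * card V"
    using s1 s2 s3 s4 s5 split[OF QC, of x] split[OF Q'(4), of v] cards \<alpha>\<beta>
    by (simp add: sum.distrib)
  moreover have "x \<in> V - {z}" "v \<in> V - {z}" "x \<noteq> v"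
    using x v CV xR by (auto simp: R_def)
  ultimately show ?thesis using nadj by blast
qed

section \<open>Splitting a cycle at two vertices, and paths to the first vertex in a set\<close>

lemma cycle_split:
  assumes "is_cycle E C" "c \<in> set C" "d \<in> set C" "c \<noteq> d"
  obtains g h where "distinct (c # g @ d # h)" "set (c # g @ d # h) = set C"
    "successively E (c # g @ [d])" "successively E (d # h @ [c])"
proof -
  obtain xs ys where C: "C = xs @ c # ys"
    using assms(2) by (meson split_list)
  have rot: "successively E (c # (ys @ xs) @ [c])"
  proof (cases xs)
    case Nil
    then show ?thesis using assms(1) by (simp add: is_cycle_def C)
  next
    case (Cons x xs')
    then show ?thesis
      using assms(1) successively_append_overlap[of E xs c "ys @ [x]"] successively_append_overlap[of E "c # ys" x "xs' @ [c]"]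
      by (simp add: is_cycle_def C)
  qed
  have "d \<in> set (ys @ xs)" using assms C by auto
  then obtain g h where gh: "ys @ xs = g @ d # h" by (meson split_list)
  have "distinct (c # ys @ xs)" "set C = set (c # ys @ xs)"
    using assms(1) by (auto simp: is_cycle_def C)
  moreover have "successively E (c # g @ [d])" "successively E (d # h @ [c])"
    using rot successively_append_overlap[of E "c # g" d "h @ [c]"] unfolding gh by auto
  ultimately show thesis
    using that[of g h] by (simp add: gh)
qed

text \<open>Induction prepends one vertex at a time. A vertex that already occurs on the path found
  so far makes the path be cut there, which keeps it distinct. The end \<open>d\<close> may differ
  from \<open>c\<close>.\<close>

lemma rtranclp_first_hit:
  assumes "E\<^sup>*\<^sup>* y c" "c \<in> C" "y \<notin> C"
  obtains q d where "d \<in> C" "distinct (y # q)" "set (y # q) \<inter> C = {}" "successively E (y # q @ [d])"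
proof -
  have "\<exists>q d. d \<in> C \<and> distinct (y # q) \<and> set (y # q) \<inter> C = {} \<and> successively E (y # q @ [d])"
    using assms
  proof (induction rule: converse_rtranclp_induct)
    case (step y y')
    show ?case
    proof (cases "y' \<in> C")
      case True
      then show ?thesis
        using step by (intro exI[of _ "[]"] exI[of _ y']) auto
    next
      case False
      then obtain q d where q: "d \<in> C" "distinct (y' # q)" "set (y' # q) \<inter> C = {}"
        "successively E (y' # q @ [d])"
        using step by blast
      show ?thesis
      proof (cases "y \<in> set (y' # q)")
        case True
        then obtain l1 l2 where l: "y' # q = l1 @ y # l2" by (meson split_list)
        have "successively E (l1 @ y # l2 @ [d])"
          using q(4) l by (metis append.assoc append_Cons)
        then have "successively E (y # l2 @ [d])"
          using successively_append_overlap by metis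
        moreover have "distinct (y # l2)" "set (y # l2) \<subseteq> set (y' # q)"
          using q(2) unfolding l by auto
        ultimately show ?thesis
          using q by blast
      next
        case False
        then have "distinct (y # y' # q)" "set (y # y' # q) \<inter> C = {}" "successively E (y # (y' # q) @ [d])"
          using q step by auto
        then show ?thesis
          using q(1) by blast
      qed
    qed
  qed simp
  then show thesis using that by blast
qed

section \<open>Degree sums in the absence of a bypass\<close>

definition no_bypass :: "('a \<Rightarrow> 'a \<Rightarrow> bool) \<Rightarrow> 'a \<Rightarrow> 'a set \<Rightarrow> bool" where
  "no_bypass E z C \<longleftrightarrow> (\<forall>c\<in>C. \<forall>d\<in>C. \<forall>p. c \<noteq> d \<longrightarrow> distinct p \<longrightarrow> set p \<inter> C = {} \<longrightarrow>
     successively E (c # p @ [d]) \<longrightarrow> set p \<subseteq> {z})"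

lemma no_bypassD:
  "\<lbrakk>no_bypass E z C; c \<in> C; d \<in> C; c \<noteq> d; x \<in> set p; x \<noteq> z; distinct p; set p \<inter> C = {};
    successively E (c # p @ [d])\<rbrakk> \<Longrightarrow> False"
  by (auto simp: no_bypass_def)

lemma no_bypass_conversep:
  assumes "no_bypass E z C"
  shows "no_bypass E\<inverse>\<inverse> z C"
  unfolding no_bypass_def
proof (intro ballI allI impI)
  fix c d p
  assume *: "c \<in> C" "d \<in> C" "c \<noteq> d" "distinct p" "set p \<inter> C = {}"
    and "successively E\<inverse>\<inverse> (c # p @ [d])"
  then have "successively E (rev (c # p @ [d]))"
    by (simp only: successively_conversep_rev)
  then have "successively E (d # rev p @ [c])" by simp
  then have "x = z" if "x \<in> set p" for x
    using no_bypassD[OF assms *(2,1) *(3)[symmetric], of x "rev p"] * that by fastforce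
  then show "set p \<subseteq> {z}" by blast
qed

text \<open>Strong connectivity leads from \<open>y\<close> back to \<open>C\<close>, and without a
  bypass only to \<open>c\<close>. So \<open>y\<close> has at most two arcs with \<open>C\<close>.
  If the arc from \<open>y\<close> to \<open>c\<close> is present as well, then \<open>z\<close> has
  no excess, which compensates for it.\<close>

lemma no_bypass_degree_sum_attached:
  assumes fin: "finite V" and irr: "\<And>u. \<not> E u u"
    and conn: "\<And>u w. u \<in> V \<Longrightarrow> w \<in> V \<Longrightarrow> E\<^sup>*\<^sup>* u w"
    and C: "C \<subseteq> V" and nb: "no_bypass E z C"
    and cy: "c \<in> C" "y \<in> V - C" "y \<noteq> z" "E c y"
    and v: "v \<in> C" "v \<noteq> c"
  shows "\<not> E y v" "\<not> E v y" "deg V E y + deg V E v + 2 \<le> 2 * card V"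
proof -
  define R where "R = V - C"
  have finC: "finite C" using C fin by (rule finite_subset)
  have noout: "\<not> E y d" if "d \<in> C" "d \<noteq> c" for d
    by (rule notI, rule no_bypassD[OF nb cy(1) that(1) that(2)[symmetric], of y "[y]"]) (use cy in auto)
  obtain q d where q: "d \<in> C" "distinct (y # q)" "set (y # q) \<inter> C = {}" "successively E (y # q @ [d])"
  proof (rule rtranclp_first_hit)
    show "E\<^sup>*\<^sup>* y c" using conn cy C by blast
    show "c \<in> C" "y \<notin> C" using cy by auto
  qed
  \<comment> \<open>Otherwise the arc from \<open>c\<close> to \<open>y\<close> and the path found
    would form a bypass from \<open>c\<close> to \<open>d\<close>.\<close>
  have d: "d = c"
    by (rule ccontr, rule no_bypassD[OF nb cy(1) q(1), of y "y # q"]) (use q cy in auto)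
  \<comment> \<open>Such an arc followed by the return path to \<open>c\<close> would be a
    bypass.\<close>
  have noin: "\<not> E u y" if "u \<in> C" "u \<noteq> c" for u
    by (rule notI, rule no_bypassD[OF nb that(1) cy(1) that(2), of y "y # q"]) (use q d cy in auto)
  have out: "\<not> (E y w \<and> E w v)" if "w \<in> R - {y}" for w
    by (rule notI, rule no_bypassD[OF nb cy(1) v(1) v(2)[symmetric], of y "[y, w]"])
      (use cy that in \<open>auto simp: R_def\<close>)
  \<comment> \<open>From \<open>v\<close> through \<open>w\<close> one reaches \<open>c\<close>
    along the return path, entered at \<open>w\<close> if \<open>w\<close> lies on it and at
    \<open>y\<close> otherwise. In the first case \<open>y\<close> is skipped, so
    \<open>w = z\<close> remains possible; a direct arc from \<open>y\<close> to \<open>c\<close>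
    excludes even that.\<close>
  have into: "w = z \<and> \<not> E y c" if w: "w \<in> R - {y}" "E v w" "E w y" for w
  proof
    show "w = z"
    proof (rule ccontr)
      assume wz: "w \<noteq> z"
      show False
      proof (cases "w \<in> set q")
        case True
        then obtain q1 q2 where q12: "q = q1 @ w # q2" by (meson split_list)
        have "successively E (v # (w # q2) @ [c])"
          using q(4) w successively_append_overlap[of E "y # q1" w "q2 @ [d]"] by (simp add: q12 d)
        then show ?thesis
          by (rule no_bypassD[OF nb v(1) cy(1) v(2) _ wz, rotated 3]) (use q in \<open>auto simp: q12\<close>)
      next
        case False
        show ?thesis
          by (rule no_bypassD[OF nb v(1) cy(1) v(2) _ wz, of "w # y # q"])
            (use False q w d in \<open>auto simp: R_def\<close>)
      qed
    qed
    show "\<not> E y c"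
      by (rule notI, rule no_bypassD[OF nb v(1) cy(1) v(2), of y "[w, y]"])
        (use cy w in \<open>auto simp: R_def\<close>)
  qed
  show nadj: "\<not> E y v" "\<not> E v y"
    using noout noin v by auto
  define \<alpha> where "\<alpha> = (of_bool (E y c) :: nat)"
  have \<alpha>: "\<alpha> \<le> 1" by (simp add: \<alpha>_def)
  have s1: "(\<Sum>w\<in>C. marcs E y w) = 1 + \<alpha>"
  proof -
    have "(\<Sum>w\<in>C. marcs E y w) = marcs E y c + (\<Sum>w\<in>C - {c}. marcs E y w)"
      using finC cy by (simp add: sum.remove)
    also have "(\<Sum>w\<in>C - {c}. marcs E y w) = 0"
      using noout noin by (intro sum.neutral) (auto simp: marcs_def)
    finally show ?thesis using cy by (simp add: marcs_def \<alpha>_def)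
  qed
  have s2: "(\<Sum>w\<in>C. marcs E v w) + 2 \<le> 2 * card C"
    using finC v irr by (intro sum_marcs_self_le) auto
  have s3: "(\<Sum>w\<in>R. marcs E y w + marcs E v w) + 2 \<le> 2 * card R + (1 - \<alpha>)"
  proof (rule sum_le_with_excess[where x = y and z = z])
    show "marcs E y y + marcs E v y = 0"
      using irr nadj by (simp add: marcs_def)
    fix w assume w: "w \<in> R - {y}"
    have "of_bool (E y w) + of_bool (E w v) \<le> (1 :: nat)"
      using out[OF w] by auto
    moreover have "of_bool (E v w) + of_bool (E w y) \<le> 1 + (if w = z then 1 - \<alpha> else 0)"
      using into[OF w] by (cases "E v w"; cases "E w y") (simp_all add: \<alpha>_def)
    ultimately show "marcs E y w + marcs E v w \<le> 2 + (if w = z then 1 - \<alpha> else 0)"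
      unfolding marcs_def by linarith
  qed (use fin cy in \<open>auto simp: R_def\<close>)
  have "deg V E u = (\<Sum>w\<in>C. marcs E u w) + (\<Sum>w\<in>R. marcs E u w)" for u
    unfolding deg_def R_def using sum.subset_diff[OF C fin] by (simp add: add.commute)
  moreover have "card C + card R = card V"
    unfolding R_def using C fin by (metis card_Diff_subset finC card_mono le_add_diff_inverse)
  ultimately show "deg V E y + deg V E v + 2 \<le> 2 * card V"
    using s1 s2 s3 \<alpha> by (simp add: sum.distrib)
qed

text \<open>Off \<open>C\<close>, the vertex \<open>v\<close> can be adjacent only to
  \<open>z\<close>. Up to four arcs at \<open>z\<close> are affordable, since \<open>y\<close> has
  no arcs with \<open>C\<close> at all.\<close>

lemma no_bypass_degree_sum_separated:
  assumes fin: "finite V" and irr: "\<And>u. \<not> E u u"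
    and C: "C \<subseteq> V" and "z \<notin> C"
    and sep: "\<And>c y. c \<in> C \<Longrightarrow> y \<in> V - C - {z} \<Longrightarrow> \<not> E c y \<and> \<not> E y c"
    and y: "y \<in> V - C - {z}" and v: "v \<in> C"
  shows "deg V E y + deg V E v + 2 \<le> 2 * card V"
proof -
  define R where "R = V - C"
  have finC: "finite C" using C fin by (rule finite_subset)
  have s1: "(\<Sum>w\<in>C. marcs E y w) = 0"
    using sep y by (intro sum.neutral) (auto simp: marcs_def)
  have s2: "(\<Sum>w\<in>C. marcs E v w) + 2 \<le> 2 * card C"
    using finC v irr by (intro sum_marcs_self_le) auto
  have s3: "(\<Sum>w\<in>R. marcs E y w + marcs E v w) + 2 \<le> 2 * card R + 2"
  proof (rule sum_le_with_excess[where x = y and z = z])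
    show "marcs E y y + marcs E v y = 0"
      using irr sep[OF v y] by (simp add: marcs_def)
    fix w assume w: "w \<in> R - {y}"
    show "marcs E y w + marcs E v w \<le> 2 + (if w = z then 2 else 0)"
      using sep[OF v, of w] w by (auto simp: marcs_def R_def of_bool_def)
  qed (use fin y in \<open>auto simp: R_def\<close>)
  have "deg V E u = (\<Sum>w\<in>C. marcs E u w) + (\<Sum>w\<in>R. marcs E u w)" for u
    unfolding deg_def R_def using sum.subset_diff[OF C fin] by (simp add: add.commute)
  moreover have "card C + card R = card V"
    unfolding R_def using C fin by (metis card_Diff_subset finC card_mono le_add_diff_inverse)
  ultimately show ?thesis
    using s1 s2 s3 by (simp add: sum.distrib)
qed

lemma is_cycle_subset:
  assumes EV: "\<And>u w. E u w \<Longrightarrow> u \<in> V \<and> w \<in> V" and "is_cycle E C"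
  shows "set C \<subseteq> V"
proof -
  have "successively E xs \<Longrightarrow> 2 \<le> length xs \<Longrightarrow> set xs \<subseteq> V" for xs
    by (induction xs rule: induct_list012) (use EV in \<open>force simp: Suc_le_eq\<close>)+
  from this[of "C @ [hd C]"] show ?thesis
    using assms(2) by (auto simp: is_cycle_def)
qed

lemma no_bypass_degree_sum:
  assumes fin: "finite V" and EV: "\<And>u w. E u w \<Longrightarrow> u \<in> V \<and> w \<in> V" and irr: "\<And>u. \<not> E u u"
    and conn: "\<And>u w. u \<in> V \<Longrightarrow> w \<in> V \<Longrightarrow> E\<^sup>*\<^sup>* u w"
    and C: "is_cycle E C" and nb: "no_bypass E z (set C)"
    and opt: "\<And>K. is_cycle E K \<Longrightarrow> weight z (set K) \<le> weight z (set C)"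
    and y0: "y0 \<in> V - set C - {z}"
  shows "\<exists>x\<in>V - {z}. \<exists>v\<in>V - {z}. x \<noteq> v \<and> \<not> E x v \<and> \<not> E v x \<and> deg V E x + deg V E v + 2 \<le> 2 * card V"
proof -
  have CV: "set C \<subseteq> V" using is_cycle_subset[OF EV C] .
  have len: "2 \<le> card (set C)" using C by (simp add: is_cycle_def distinct_card)
  \<comment> \<open>The partner of \<open>y\<close> must differ from \<open>c\<close> and
    \<open>z\<close>. If there were none, \<open>C\<close> would consist of \<open>c\<close> and
    \<open>z\<close> and have weight 3, whereas a cycle through \<open>c\<close> and
    \<open>y\<close>, both different from \<open>z\<close>, has weight at least 4.\<close>
  have ex_v: "\<exists>v\<in>set C. v \<noteq> c \<and> v \<noteq> z" if c: "c \<in> set C" and w: "is_cycle E K" "{c, y} \<subseteq> set K" "y \<notin> set C" "y \<noteq> z" for c y K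
  proof (rule ccontr)
    assume "\<not> (\<exists>v\<in>set C. v \<noteq> c \<and> v \<noteq> z)"
    then have sub: "set C \<subseteq> {c, z}" by blast
    have "card (set C) \<le> card {c, z}" using sub by (intro card_mono) auto
    then have cz: "c \<noteq> z" using len by (cases "c = z") auto
    have "card (set C) \<le> 2" using \<open>card (set C) \<le> card {c, z}\<close> cz by simp
    moreover have "card (set C - {z}) \<le> card {c}" using sub by (intro card_mono) auto
    ultimately have "weight z (set C) \<le> 3" by (simp add: weight_def)
    moreover have "c \<noteq> y" "{c, y} - {z} = {c, y}" using c w cz by auto
    then have "weight z {c, y} = 4" by (simp add: weight_def)
    moreover have "weight z {c, y} \<le> weight z (set K)" using w by (intro weight_mono) auto
    ultimately show False using opt[OF w(1)] by linarith
  qed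
  consider (1) c y where "c \<in> set C" "y \<in> V - set C - {z}" "E c y"
    | (2) c y where "c \<in> set C" "y \<in> V - set C - {z}" "E y c"
    | (3) "\<And>c y. c \<in> set C \<Longrightarrow> y \<in> V - set C - {z} \<Longrightarrow> \<not> E c y \<and> \<not> E y c"
    by blast
  then show ?thesis
  proof cases
    case 1
    \<comment> \<open>With target \<open>{c}\<close> the path may meet \<open>C\<close> elsewhere.
      This is harmless, as only a cycle through \<open>c\<close> and \<open>y\<close> is
      wanted.\<close>
    obtain q where "distinct (y # q)" "set (y # q) \<inter> {c} = {}" "successively E (y # q @ [c])"
      using rtranclp_first_hit[of E y c "{c}"] conn[of y c] 1 CV by (metis DiffE singletonD singletonI subsetD)
    then have "is_cycle E (c # y # q)" using 1 by (auto simp: is_cycle_def)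
    then obtain v where v: "v \<in> set C" "v \<noteq> c" "v \<noteq> z"
      using ex_v[of c "c # y # q" y] 1 by auto
    then show ?thesis
      using no_bypass_degree_sum_attached[OF fin irr conn CV nb 1(1) _ _ 1(3) v(1,2)] 1(2) CV
      by (intro bexI[of _ y] bexI[of _ v]) auto
  next
    case 2
    \<comment> \<open>The mirror image of the previous case, handled in the reversed digraph, which
      has the same degrees.\<close>
    have conn': "E\<inverse>\<inverse>\<^sup>*\<^sup>* u w" if "u \<in> V" "w \<in> V" for u w
      using conn[OF that(2,1)] by (simp add: rtranclp_conversep)
    obtain q where q: "distinct (y # q)" "set (y # q) \<inter> {c} = {}" "successively E\<inverse>\<inverse> (y # q @ [c])"
      using rtranclp_first_hit[of "E\<inverse>\<inverse>" y c "{c}"] conn'[of y c] 2 CV by (metis DiffE singletonD singletonI subsetD)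
    have "successively E (rev (y # q @ [c]))"
      using q(3) by (simp only: successively_conversep_rev)
    then have "successively E (c # rev q @ [y])" by simp
    then have K: "is_cycle E (c # rev q @ [y])"
      using q(1,2) 2 successively_append_overlap[of E "c # rev q" y "[c]"] by (auto simp: is_cycle_def)
    then obtain v where v: "v \<in> set C" "v \<noteq> c" "v \<noteq> z"
      using ex_v[OF _ K, of c y] 2 by auto
    have "\<not> E\<inverse>\<inverse> y v" "\<not> E\<inverse>\<inverse> v y" "deg V E\<inverse>\<inverse> y + deg V E\<inverse>\<inverse> v + 2 \<le> 2 * card V"
      using no_bypass_degree_sum_attached[OF fin _ conn' CV no_bypass_conversep[OF nb] 2(1) _ _ _ v(1,2)] 2 irr
      by auto
    then show ?thesis
      using 2 v CV by (intro bexI[of _ y] bexI[of _ v]) auto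
  next
    case 3
    have "C \<noteq> []" using C by (auto simp: is_cycle_def)
    then obtain v where v: "v \<in> set C" using last_in_set by blast
    \<comment> \<open>If \<open>z\<close> were on \<open>C\<close>, the last vertex before a path
      from \<open>y0\<close> enters \<open>C\<close> would be a vertex other than \<open>z\<close>
      off \<open>C\<close> with an arc to \<open>C\<close>.\<close>
    have "z \<notin> set C"
    proof
      assume z: "z \<in> set C"
      obtain q d where q: "d \<in> set C" "set (y0 # q) \<inter> set C = {}" "successively E (y0 # q @ [d])"
        using rtranclp_first_hit[OF conn[of y0 v], of "set C"] v y0 CV by (metis DiffE subsetD)
      then have "E (last (y0 # q)) d"
        using successively_append_iff[of E "y0 # q" "[d]"] by simp
      moreover have "last (y0 # q) \<in> V - set C - {z}"
        using calculation EV q(2) z last_in_set[of "y0 # q"] by blast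
      ultimately show False using 3 q(1) by blast
    qed
    then show ?thesis
      using no_bypass_degree_sum_separated[OF fin irr CV _ 3 y0 v] 3[OF v y0] v y0 CV
      by (intro bexI[of _ y0] bexI[of _ v]) auto
  qed
qed

section \<open>Choosing the extremal cycle and bypass\<close>

theorem cycle_through_all_but_one:
  assumes fin: "finite V" and EV: "\<And>u w. E u w \<Longrightarrow> u \<in> V \<and> w \<in> V" and irr: "\<And>u. \<not> E u u"
    and conn: "\<And>u w. u \<in> V \<Longrightarrow> w \<in> V \<Longrightarrow> E\<^sup>*\<^sup>* u w"
    and card: "2 \<le> card V"
    and degs: "\<And>x v. \<lbrakk>x \<in> V - {z}; v \<in> V - {z}; x \<noteq> v; \<not> E x v; \<not> E v x\<rbrakk>
      \<Longrightarrow> 2 * card V \<le> deg V E x + deg V E v + 1"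
  shows "\<exists>C. is_cycle E C \<and> V - {z} \<subseteq> set C"
proof -
  have CV: "set C \<subseteq> V" if "is_cycle E C" for C using is_cycle_subset[OF EV that] .
  \<comment> \<open>Any arc closes up to a cycle with a path from its head back to its tail.\<close>
  have "\<exists>C. is_cycle E C"
  proof -
    obtain u w where uw: "u \<in> V" "w \<in> V" "u \<noteq> w"
      using card by (metis card_le_Suc0_iff_eq fin not_less_eq_eq numeral_2_eq_2)
    then obtain u' where u': "E u u'" using conn[of u w] by (metis converse_rtranclpE)
    then have "u' \<noteq> u" "u' \<in> V" using irr EV by metis+
    then obtain q where "distinct (u' # q)" "set (u' # q) \<inter> {u} = {}" "successively E (u' # q @ [u])"
      using rtranclp_first_hit[OF conn[of u' u], of "{u}"] uw by (metis singletonD singletonI)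
    then have "is_cycle E (u # u' # q)" using u' by (auto simp: is_cycle_def)
    then show ?thesis by blast
  qed
  then obtain C0 where "is_cycle E C0" by blast
  moreover have "weight z (set C) < Suc (weight z V)" if "is_cycle E C" for C
    using weight_mono[OF fin CV[OF that], of z] by simp
  ultimately obtain C where C: "is_cycle E C"
    and opt: "\<And>K. is_cycle E K \<Longrightarrow> weight z (set K) \<le> weight z (set C)"
    using ex_has_greatest_nat[of "is_cycle E" C0 "\<lambda>C. weight z (set C)" "Suc (weight z V)"] by blast
  have "V - {z} \<subseteq> set C"
  proof (rule ccontr)
    assume "\<not> V - {z} \<subseteq> set C"
    then obtain y0 where y0: "y0 \<in> V - set C - {z}" by blast
    \<comment> \<open>In both cases there is a non-adjacent pair with degree sum at most 2|V| - 2,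
      one below the assumed bound.\<close>
    have "\<exists>x\<in>V - {z}. \<exists>v\<in>V - {z}. x \<noteq> v \<and> \<not> E x v \<and> \<not> E v x \<and> deg V E x + deg V E v + 2 \<le> 2 * card V"
    proof (cases "no_bypass E z (set C)")
      case True
      show ?thesis using no_bypass_degree_sum[OF fin EV irr conn C True opt y0] .
    next
      case False
      then obtain c d p where p: "c \<in> set C" "d \<in> set C" "c \<noteq> d" "distinct p" "set p \<inter> set C = {}"
        "successively E (c # p @ [d])" "\<not> set p \<subseteq> {z}"
        by (auto simp: no_bypass_def)
      \<comment> \<open>All bypasses of all cycles on the vertex set of \<open>C\<close> are
        collected as tuples, to pick one with the shortest gap.\<close>
      define P where "P = (\<lambda>(a, g, b, h, p). theta E a g b h p \<and> \<not> set p \<subseteq> {z} \<and> set (a # g @ b # h) = set C)"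
      obtain g h where gh: "distinct (c # g @ d # h)" "set (c # g @ d # h) = set C"
          "successively E (c # g @ [d])" "successively E (d # h @ [c])"
        using cycle_split[OF C p(1-3)] by blast
      have "P (c, g, d, h, p)"
        using gh p unfolding P_def theta_def by auto
      then obtain t where "P t" and tmin: "\<And>t'. P t' \<Longrightarrow> length (fst (snd t)) \<le> length (fst (snd t'))"
        using ex_has_least_nat[of P _ "\<lambda>t. length (fst (snd t))"] by metis
      obtain a g b h p where t: "t = (a, g, b, h, p)" by (metis prod_cases5)
      have S: "set (a # g @ b # h) = set C" using \<open>P t\<close> by (simp add: P_def t)
      have "min_theta E z a g b h p"
        unfolding min_theta_def S
      proof (intro conjI allI impI)
        fix a' g' b' h' p'
        assume "theta E a' g' b' h' p'" "\<not> set p' \<subseteq> {z}" "set (a' # g' @ b' # h') = set C"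
        then have "P (a', g', b', h', p')" unfolding P_def by simp
        from tmin[OF this] show "length g \<le> length g'" by (simp add: t)
      qed (use \<open>P t\<close> in \<open>auto simp: P_def t\<close>)
      from min_theta_degree_sum[OF fin EV irr this opt[folded S]] show ?thesis .
    qed
    then show False using degs by fastforce
  qed
  then show ?thesis using C by blast
qed


section \<open>Transfer from vertex lists to arc walks\<close>

lemma (in wf_digraph) awalk_of_successively:
  assumes "successively (dominates G) (u # l @ [v])"
  shows "\<exists>p. awalk u p v \<and> awalk_verts u p = u # l @ [v]"
  using assms
proof (induction l arbitrary: u)
  case Nil
  then obtain e where "arc e (u, v)" by (auto simp: arcs_ends_conv arc_def)
  then show ?case
    by (intro exI[of _ "[e]"]) (auto simp: awalk_Cons_iff awalk_Nil_iff arc_def)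
next
  case (Cons w l)
  then obtain e where "arc e (u, w)" by (auto simp: arcs_ends_conv arc_def)
  moreover obtain p where "awalk w p v" "awalk_verts w p = w # l @ [v]"
    using Cons by auto
  ultimately show ?case
    by (intro exI[of _ "e # p"]) (auto simp: awalk_Cons_iff arc_def)
qed

lemma (in wf_digraph) cycle_of_is_cycle:
  assumes "is_cycle (dominates G) C"
  shows "\<exists>u p. cycle p \<and> awalk u p u \<and> set (awalk_verts u p) = set C \<and> length p = length C"
proof -
  obtain u l where C: "C = u # l"
    using assms by (cases C) (auto simp: is_cycle_def)
  obtain p where p: "awalk u p u" "awalk_verts u p = u # l @ [u]"
    using awalk_of_successively[of u l u] assms by (auto simp: is_cycle_def C)
  \<comment> \<open>The closed walk lists \<open>u\<close> at both ends, so it has one more vertex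
    entry than arcs, matching \<open>C\<close> with \<open>u\<close> appended.\<close>
  have "length p = length C"
    using arg_cong[OF p(2), of length] by (simp add: length_awalk_verts C)
  moreover have "cycle p"
    using p assms calculation by (auto simp: cycle_def is_cycle_def C intro!: exI[of _ u])
  moreover have "set (awalk_verts u p) = set C" using p(2) by (simp add: C)
  ultimately show ?thesis using p(1) by blast
qed

text \<open>Without parallel arcs, \<open>head\<close> is injective on the arcs leaving
  \<open>x\<close> and \<open>tail\<close> on those entering it, so counting arcs amounts to
  counting neighbours.\<close>

lemma (in digraph) degree_eq_deg: "degree G x = deg (verts G) (dominates G) x"
proof -
  have "out_degree G x = card {w. x \<rightarrow>\<^bsub>G\<^esub> w}"
    unfolding out_degree_def
    by (rule bij_betw_same_card[of "head G"], rule bij_betw_imageI)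
      (auto simp: inj_on_def arcs_ends_conv out_arcs_def arc_to_ends_def intro: no_multi_arcs)
  moreover have "in_degree G x = card {w. w \<rightarrow>\<^bsub>G\<^esub> x}"
    unfolding in_degree_def
    by (rule bij_betw_same_card[of "tail G"], rule bij_betw_imageI)
      (auto simp: inj_on_def arcs_ends_conv in_arcs_def arc_to_ends_def intro: no_multi_arcs)
  moreover have "{w. x \<rightarrow>\<^bsub>G\<^esub> w} = {w \<in> verts G. x \<rightarrow>\<^bsub>G\<^esub> w}" "{w. w \<rightarrow>\<^bsub>G\<^esub> x} = {w \<in> verts G. w \<rightarrow>\<^bsub>G\<^esub> x}"
    using adj_in_verts by auto
  ultimately show ?thesis
    by (simp add: degree_def deg_def marcs_def sum.distrib sum_of_bool_eq Int_def)
qed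

theorem theorem4p5:
  fixes D :: "('a, 'b) pre_digraph" and n :: nat and z0 :: 'a
  assumes "digraph D"
    and "strongly_connected D"
    and "card (verts D) = n" and "n \<ge> 3"
    and "z0 \<in> verts D"
    and "\<And>x y. \<lbrakk>x \<in> verts D - {z0}; y \<in> verts D - {z0}; x \<noteq> y; \<not> adjacent D x y\<rbrakk>
           \<Longrightarrow> degree D x + degree D y \<ge> 2 * n - 1"
  shows "hamiltonian D \<or> has_cycle_of_length D (n - 1)"
proof -
  interpret digraph D by (rule assms(1))
  have "\<exists>C. is_cycle (dominates D) C \<and> verts D - {z0} \<subseteq> set C"
  proof (rule cycle_through_all_but_one)
    show "(dominates D)\<^sup>*\<^sup>* u w" if "u \<in> verts D" "w \<in> verts D" for u w
    proof -
      have "(u, w) \<in> (arcs_ends D)\<^sup>*"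
        using assms(2) that by (auto simp: strongly_connected_def reachable_conv)
      then show ?thesis by (simp add: rtrancl_def)
    qed
    show "2 * card (verts D) \<le> deg (verts D) (dominates D) x + deg (verts D) (dominates D) v + 1"
      if "x \<in> verts D - {z0}" "v \<in> verts D - {z0}" "x \<noteq> v" "\<not> x \<rightarrow>\<^bsub>D\<^esub> v" "\<not> v \<rightarrow>\<^bsub>D\<^esub> x" for x v
      using assms(6)[OF that(1-3)] that(4,5) assms(3) by (simp add: adjacent_def degree_eq_deg)
  qed (use assms(3,4) adj_in_verts adj_not_same in auto)
  then obtain C where C: "is_cycle (dominates D) C" and sub: "verts D - {z0} \<subseteq> set C" by blast
  obtain u p where p: "cycle p" "awalk u p u" "set (awalk_verts u p) = set C" "length p = length C"
    using cycle_of_is_cycle[OF C] by blast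
  have CV: "set C \<subseteq> verts D"
    using is_cycle_subset[OF _ C] adj_in_verts by blast
  show ?thesis
  proof (cases "z0 \<in> set C")
    case True
    then have "set C = verts D" using sub CV by auto
    then show ?thesis using p by (auto simp: hamiltonian_def)
  next
    case False
    then have "set C = verts D - {z0}" using sub CV by auto
    moreover have "length C = card (set C)"
      using C by (simp add: is_cycle_def distinct_card)
    ultimately have "length p = n - 1"
      using p(4) assms(3,5) by simp
    then show ?thesis using p(1) by (auto simp: has_cycle_of_length_def)
  qed
qed

end
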